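(* Let $\mathbb{Y}$ be the set of all integer partitions and let $a,b,c,d:\mathbb{Y}\to\mathbb{R}_{\ge0}$ be functions satisfying $$a(\lambda)\,b(\mu)\ \le\ c(\lambda\vee\mu)\,d(\lambda\wedge\mu)\qquad\text{for all }\lambda,\mu\in\mathbb{Y}.$$ Then $$\sum_{\lambda\in\mathbb{Y}}a(\lambda)s_\lambda\cdot\sum_{\lambda\in\mathbb{Y}}b(\lambda)s_\lambda\ =\ \sum_{\lambda\in\mathbb{Y}}c(\lambda)s_\lambda\cdot\sum_{\lambda\in\mathbb{Y}}d(\lambda)s_\lambda$$ if and only if one of the following two conditions holds: (1) ($a\equiv0$ or $b\equiv0$) and ($c\equiv0$ or $d\equiv0$); or (2) for some constant $\theta\ne0$, either ($a=\theta\, c$ and $b=\theta^{-1}d$) or ($a=\theta\, d$ and $b=\theta^{-1}c$).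
   Context: A partition is a sequence $\lambda=(\lambda_1\ge\lambda_2\ge\dots)$ of nonnegative integers with finitely many nonzero terms. For partitions, $\lambda\vee\mu=(\max\{\lambda_i,\mu_i\})_i$ and $\lambda\wedge\mu=(\min\{\lambda_i,\mu_i\})_i$. $s_\lambda$ is the Schur function in infinitely many variables $z_1,z_2,\dots$ (homogeneous of degree $|\lambda|=\sum_i\lambda_i$). The functions $a,b,c,d$ may have infinite support; the sums are formal infinite sums of symmetric functions (formal power series; each degree contains only finitely many terms), and equality is equality of formal power series. *)

theory Defs
  imports Complex_Main "HOL-Library.Poly_Mapping"
begin

section \<open>Partitions and their lattice operations\<close>

text \<open>The part with index \<open>i\<close> is $\lambda_{i+1}$: parts are numbered from \<open>0\<close>.\<close>

typedef partition = "{f :: nat \<Rightarrow> nat. antimono f \<and> finite {i. f i \<noteq> 0}}"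
  morphisms part Abs_partition
  by (rule exI[of _ "\<lambda>_. 0"]) (simp add: antimono_def)

setup_lifting type_definition_partition

lemma part_antimono: "i \<le> j \<Longrightarrow> part p j \<le> part p i"
  using part[of p] by (simp add: antimono_def)

lemma finite_part_support: "finite {i. part p i \<noteq> 0}"
  using part[of p] by simp

instantiation partition :: distrib_lattice
begin

lift_definition less_eq_partition :: "partition \<Rightarrow> partition \<Rightarrow> bool"
  is "\<lambda>f g. \<forall>i. f i \<le> g i" .

definition less_partition :: "partition \<Rightarrow> partition \<Rightarrow> bool"
  where "less_partition p q \<longleftrightarrow> p \<le> q \<and> \<not> q \<le> p"

lift_definition sup_partition :: "partition \<Rightarrow> partition \<Rightarrow> partition"
  is "\<lambda>f g i. max (f i) (g i)"
proof -
  fix f g :: "nat \<Rightarrow> nat"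
  assume f: "antimono f \<and> finite {i. f i \<noteq> 0}" and g: "antimono g \<and> finite {i. g i \<noteq> 0}"
  have "{i. max (f i) (g i) \<noteq> 0} \<subseteq> {i. f i \<noteq> 0} \<union> {i. g i \<noteq> 0}"
    by auto
  then have "finite {i. max (f i) (g i) \<noteq> 0}"
    using f g finite_subset by blast
  then show "antimono (\<lambda>i. max (f i) (g i)) \<and> finite {i. max (f i) (g i) \<noteq> 0}"
    using f g unfolding antimono_def by (blast intro: max.mono)
qed

lift_definition inf_partition :: "partition \<Rightarrow> partition \<Rightarrow> partition"
  is "\<lambda>f g i. min (f i) (g i)"
proof -
  fix f g :: "nat \<Rightarrow> nat"
  assume f: "antimono f \<and> finite {i. f i \<noteq> 0}" and g: "antimono g \<and> finite {i. g i \<noteq> 0}"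
  have "{i. min (f i) (g i) \<noteq> 0} \<subseteq> {i. f i \<noteq> 0}"
    by auto
  then have "finite {i. min (f i) (g i) \<noteq> 0}"
    using f finite_subset by blast
  then show "antimono (\<lambda>i. min (f i) (g i)) \<and> finite {i. min (f i) (g i) \<noteq> 0}"
    using f g by (auto simp: antimono_def min_le_iff_disj)
qed

instance
proof
  fix p q r :: partition
  show "(p < q) = (p \<le> q \<and> \<not> q \<le> p)" by (rule less_partition_def)
  show "p \<le> p" by transfer simp
  show "p \<le> q \<Longrightarrow> q \<le> r \<Longrightarrow> p \<le> r" by transfer (meson order_trans)
  show "p \<le> q \<Longrightarrow> q \<le> p \<Longrightarrow> p = q" by transfer (auto intro!: ext antisym)
  show "inf p q \<le> p" "inf p q \<le> q" by (transfer, simp)+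
  show "p \<le> q \<Longrightarrow> p \<le> r \<Longrightarrow> p \<le> inf q r" by transfer simp
  show "p \<le> sup p q" "q \<le> sup p q" by (transfer, simp)+
  show "q \<le> p \<Longrightarrow> r \<le> p \<Longrightarrow> sup q r \<le> p" by transfer simp
  show "sup p (inf q r) = inf (sup p q) (sup p r)"
    by transfer (simp add: max_min_distrib2)
qed

end

section \<open>Formal power series in countably many variables\<close>

text \<open>
  A monomial in $z_1, z_2, \ldots$ is its exponent vector, with \<open>i\<close> standing for the variable
  $z_{i+1}$. A series is its coefficient function, so equality of series is
  equality of all coefficients.
\<close>

type_synonym monomial = "nat \<Rightarrow>\<^sub>0 nat"
type_synonym power_series = "monomial \<Rightarrow> real"

definition ps_mult :: "power_series \<Rightarrow> power_series \<Rightarrow> power_series"  (infixl "\<odot>" 70)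
  where "(f \<odot> g) m = (\<Sum>(u, v) \<in> {(u, v). u + v = m}. f u * g v)"

lemma finite_monomial_splits: "finite {(u, v). u + v = (m :: monomial)}"
proof -
  let ?A = "Poly_Mapping.keys m" and ?B = "{..\<Sum>i\<in>Poly_Mapping.keys m. Poly_Mapping.lookup m i}"
  let ?F = "{f. \<forall>x. (x \<in> ?A \<longrightarrow> f x \<in> ?B) \<and> (x \<notin> ?A \<longrightarrow> f x = (0 :: nat))}"
  have F: "finite ?F"
    by (rule finite_set_of_finite_funs) auto
  have *: "Poly_Mapping.lookup u \<in> ?F" if "u + v = m" for u v :: monomial
  proof -
    have le: "Poly_Mapping.lookup u x \<le> Poly_Mapping.lookup m x" for x
      using that by (auto simp: lookup_add)
    have "Poly_Mapping.lookup u x = 0" if "x \<notin> ?A" for x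
      using le[of x] that by (simp add: in_keys_iff)
    moreover have "Poly_Mapping.lookup u x \<le> (\<Sum>i\<in>?A. Poly_Mapping.lookup m i)" if "x \<in> ?A" for x
      using le[of x] member_le_sum[of x ?A "Poly_Mapping.lookup m"] that
      by (auto intro: order_trans)
    ultimately show ?thesis by simp
  qed
  have "{(u, v). u + v = m} \<subseteq> (Poly_Mapping.lookup -` ?F) \<times> (Poly_Mapping.lookup -` ?F)"
  proof (rule subsetI, elim CollectE case_prodE)
    fix x u v assume "x = (u, v)" "u + v = m"
    then show "x \<in> (Poly_Mapping.lookup -` ?F) \<times> (Poly_Mapping.lookup -` ?F)"
      using *[of u v] *[of v u] by (simp add: add.commute)
  qed
  moreover have "finite (Poly_Mapping.lookup -` ?F)"
    using F by (rule finite_vimageI) (auto intro: injI poly_mapping_eqI)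
  ultimately show ?thesis
    by (meson finite_SigmaI finite_subset)
qed

section \<open>Schur functions\<close>

definition diagram :: "partition \<Rightarrow> (nat \<times> nat) set"
  where "diagram p = {(i, j). j < part p i}"

text \<open>
  The entry \<open>k\<close> of a tableau contributes the variable with index \<open>k\<close>, so entries start at \<open>0\<close>.
  A tableau is a total function; it is pinned to \<open>0\<close> outside the diagram so that distinct
  functions are distinct tableaux.
\<close>

definition semistandard :: "partition \<Rightarrow> (nat \<times> nat \<Rightarrow> nat) \<Rightarrow> bool"
  where "semistandard p T \<longleftrightarrow>
    (\<forall>x. x \<notin> diagram p \<longrightarrow> T x = 0) \<and>
    (\<forall>i j j'. j < j' \<and> (i, j') \<in> diagram p \<longrightarrow> T (i, j) \<le> T (i, j')) \<and>
    (\<forall>i i' j. i < i' \<and> (i', j) \<in> diagram p \<longrightarrow> T (i, j) < T (i', j))"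

definition weight :: "partition \<Rightarrow> (nat \<times> nat \<Rightarrow> nat) \<Rightarrow> monomial"
  where "weight p T = (\<Sum>x\<in>diagram p. Poly_Mapping.single (T x) 1)"

definition schur :: "partition \<Rightarrow> power_series"
  where "schur p m = real (card {T. semistandard p T \<and> weight p T = m})"

lemma finite_diagram: "finite (diagram p)"
proof -
  have "diagram p = (SIGMA i:{i. part p i \<noteq> 0}. {..<part p i})"
    by (auto simp: diagram_def)
  then show ?thesis
    using finite_part_support by simp
qed

lemma lookup_weight:
  "Poly_Mapping.lookup (weight p T) k = card {x \<in> diagram p. T x = k}"
proof -
  have "Poly_Mapping.lookup (weight p T) k = (\<Sum>x\<in>diagram p. if T x = k then 1 else 0)"
    unfolding weight_def lookup_sum lookup_single when_def by (rule sum.cong) auto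
  also have "\<dots> = card {x \<in> diagram p. T x = k}"
    using finite_diagram by (simp add: sum.If_cases Int_def)
  finally show ?thesis .
qed

lemma keys_weight: "Poly_Mapping.keys (weight p T) = T ` diagram p"
  using finite_diagram[of p] by (force simp: in_keys_iff lookup_weight card_eq_0_iff image_iff)

lemma sum_lookup_weight:
  "(\<Sum>k\<in>Poly_Mapping.keys (weight p T). Poly_Mapping.lookup (weight p T) k) = card (diagram p)"
  using card_eq_sum[of "diagram p"] sum.image_gen[OF finite_diagram, of "\<lambda>_. 1 :: nat" p T]
  by (simp add: keys_weight lookup_weight)

lemma finite_tableaux: "finite {T. semistandard p T \<and> weight p T = m}"
proof (rule finite_subset)
  let ?F = "{T. \<forall>x. (x \<in> diagram p \<longrightarrow> T x \<in> Poly_Mapping.keys m) \<and> (x \<notin> diagram p \<longrightarrow> T x = 0)}"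
  show "{T. semistandard p T \<and> weight p T = m} \<subseteq> ?F"
    by (auto simp: semistandard_def keys_weight)
  show "finite ?F"
    by (rule finite_set_of_finite_funs) (auto simp: finite_diagram)
qed

lemma card_diagram: "card (diagram p) = (\<Sum>i | part p i \<noteq> 0. part p i)"
proof -
  have "diagram p = (SIGMA i:{i. part p i \<noteq> 0}. {..<part p i})"
    by (auto simp: diagram_def)
  then show ?thesis
    using finite_part_support by simp
qed

lemma schur_homogeneous:
  assumes "schur p m \<noteq> 0"
  shows "(\<Sum>k\<in>Poly_Mapping.keys m. Poly_Mapping.lookup m k) = (\<Sum>i | part p i \<noteq> 0. part p i)"
proof -
  have "{T. semistandard p T \<and> weight p T = m} \<noteq> {}"
    using assms unfolding schur_def by (metis card.empty of_nat_0)
  then show ?thesis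
    using sum_lookup_weight card_diagram by fastforce
qed

lemma finite_partitions_of_size: "finite {p. card (diagram p) = n}"
proof -
  let ?F = "{f. \<forall>x. (x \<in> {..<n} \<longrightarrow> f x \<in> {..n}) \<and> (x \<notin> {..<n} \<longrightarrow> f x = (0 :: nat))}"
  have F: "finite ?F"
    by (rule finite_set_of_finite_funs) auto
  have "part p \<in> ?F" if n: "card (diagram p) = n" for p
  proof -
    have "part p x \<le> n" for x
    proof -
      have "Pair x ` {..<part p x} \<subseteq> diagram p"
        by (auto simp: diagram_def)
      then have "card (Pair x ` {..<part p x}) \<le> n"
        using card_mono[OF finite_diagram] n by blast
      then show ?thesis
        by (simp add: card_image inj_on_def)
    qed
    moreover have "part p x = 0" if "x \<ge> n" for x
    proof (rule ccontr)
      assume "part p x \<noteq> 0"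
      then have "(\<lambda>i. (i, 0)) ` {..x} \<subseteq> diagram p"
        using part_antimono[of _ x p] by (fastforce simp: diagram_def)
      then have "card ((\<lambda>i. (i, 0 :: nat)) ` {..x}) \<le> n"
        using card_mono[OF finite_diagram] n by blast
      then show False
        using that by (simp add: card_image inj_on_def)
    qed
    ultimately show ?thesis by simp
  qed
  then have "{p. card (diagram p) = n} \<subseteq> part -` ?F"
    by blast
  moreover have "finite (part -` ?F)"
    using F by (rule finite_vimageI) (auto intro: injI simp: part_inject)
  ultimately show ?thesis
    by (rule finite_subset)
qed

text \<open>
  The formal infinite sum $\sum_\lambda a(\lambda) s_\lambda$, taken coefficientwise. The constant
  \<open>Sum_any\<close> would return \<open>0\<close> for an infinite support; the lemma below excludes this case.
\<close>

definition schur_series :: "(partition \<Rightarrow> real) \<Rightarrow> power_series"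
  where "schur_series a m = Sum_any (\<lambda>p. a p * schur p m)"

lemma finite_schur_support: "finite {p. a p * schur p m \<noteq> 0}"
proof (rule finite_subset)
  let ?n = "\<Sum>k\<in>Poly_Mapping.keys m. Poly_Mapping.lookup m k"
  show "{p. a p * schur p m \<noteq> 0} \<subseteq> {p. card (diagram p) = ?n}"
    using schur_homogeneous card_diagram by fastforce
  show "finite {p. card (diagram p) = ?n}"
    by (rule finite_partitions_of_size)
qed

end

theory Submission
  imports Defs "HOL-Library.Extended_Nat"
begin

text \<open>
  View a semistandard tableau as a filling of the whole quadrant, with the entry \<open>\<infinity>\<close> outside its
  diagram. Entrywise minimum and maximum of two semistandard fillings \<open>t\<close>, \<open>u\<close> are again
  semistandard; their shapes are the join and the meet of the shapes of \<open>t\<close> and \<open>u\<close>, and the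
  total content is unchanged. So the coefficient of each monomial in a product of two Schur series
  is a sum over pairs of fillings that splits over the fibres of \<open>(t, u) \<mapsto> (inf t u, sup t u)\<close>.

  Inside one fibre the pairs arise from each other by exchanging the entries on a set \<open>S\<close> of
  cells. Writing \<open>f S\<close> for the term \<open>a (shape t) * b (shape u)\<close> and \<open>g S\<close> for the corresponding
  term of \<open>c\<close> and \<open>d\<close>, the hypothesis turns into
  \<open>f S * f (- T) \<le> g (S \<union> T) * g (- (S \<inter> T))\<close>, to which the four functions theorem of Ahlswede
  and Daykin applies (\<open>four_functions\<close>): the sum of \<open>f\<close> is at most the sum of \<open>g\<close>
  (\<open>exchange_inequality\<close>). Hence equality of the two products forces equality in every fibre
  (\<open>exchange_equality\<close>).

  Two kinds of fibres are then enough. For \<open>p \<le> q\<close> there is a fibre with no pairs except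
  \<open>(P, Q)\<close> and \<open>(Q, P)\<close>, where \<open>P\<close> has shape \<open>q\<close> and \<open>Q\<close> has shape \<open>p\<close>; it gives
  \<open>a p * b q + a q * b p = c p * d q + c q * d p\<close> (\<open>comparable_identity\<close>). For arbitrary \<open>p\<close>, \<open>q\<close>
  any fibre through tableaux of these shapes shows that \<open>c p * d q\<close> vanishes as soon as
  \<open>c (sup p q) * d (inf p q)\<close> does (\<open>vanishing_product\<close>).

  The rest is algebra. The case \<open>p = q\<close> says that the matrix with rows \<open>(a p, c p)\<close> and
  \<open>(d p, b p)\<close> has determinant zero, so it is a product of a column \<open>u\<close> and a row \<open>w\<close>, and
  the identity for \<open>p\<close> and \<open>q\<close> says that the two columns or the two rows are parallel. Together
  with the inequality this extends from comparable pairs to all pairs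
  (\<open>polarized_identity_from_comparable\<close>). Being parallel is an equivalence relation on nonzero
  vectors, and two equivalence relations whose union is everything cannot both be proper; so all
  the rows are parallel or all the columns are, which is the asserted proportionality
  (\<open>proportional_if_polarized_identity\<close>).
\<close>

section \<open>The four functions theorem\<close>

text \<open>
  This is the four functions theorem on a two-element chain. Only the cross terms need an
  argument: both \<open>a0 * b1\<close> and \<open>a1 * b0\<close> are at most \<open>c1 * d0\<close>, and their product is at most that
  of \<open>c1 * d0\<close> and \<open>c0 * d1\<close>; two numbers bounded in this way have the largest sum when one of
  them is \<open>c1 * d0\<close>.
\<close>

lemma four_functions_two_points:
  fixes a0 a1 b0 b1 c0 c1 d0 d1 :: real
  assumes nonneg: "0 \<le> a0" "0 \<le> a1" "0 \<le> b0" "0 \<le> b1" "0 \<le> c0" "0 \<le> c1" "0 \<le> d0" "0 \<le> d1"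
    and "a0 * b0 \<le> c0 * d0" "a1 * b1 \<le> c1 * d1" "a0 * b1 \<le> c1 * d0" "a1 * b0 \<le> c1 * d0"
  shows "(a0 + a1) * (b0 + b1) \<le> (c0 + c1) * (d0 + d1)"
proof -
  let ?X = "a0 * b1" and ?Y = "a1 * b0" and ?P = "c1 * d0" and ?Q = "c0 * d1"
  have "?X + ?Y \<le> ?P + ?Q"
  proof (cases "?P = 0")
    case True
    then have "?X \<le> 0" "?Y \<le> 0" "0 \<le> ?P + ?Q"
      using assms by auto
    then show ?thesis by linarith
  next
    case False
    have "0 \<le> ?P" using nonneg by simp
    then have "0 < ?P" using False by linarith
    have "?X * ?Y = (a0 * b0) * (a1 * b1)" by (simp add: mult_ac)
    also have "\<dots> \<le> (c0 * d0) * (c1 * d1)"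
      using assms by (intro mult_mono[of "a0 * b0" "c0 * d0"]) auto
    finally have "?X * ?Y \<le> ?P * ?Q" by (simp add: mult_ac)
    moreover have "0 \<le> (?P - ?X) * (?P - ?Y)"
      using assms by (intro mult_nonneg_nonneg) auto
    ultimately have "?P * (?X + ?Y) \<le> ?P * (?P + ?Q)"
      by (simp add: algebra_simps)
    then show ?thesis using \<open>0 < ?P\<close> by (simp only: mult_le_cancel_left_pos)
  qed
  then show ?thesis using assms(9,10) by (simp add: algebra_simps)
qed

lemma sum_Pow_insert:
  fixes f :: "'a set \<Rightarrow> 'b::comm_monoid_add"
  assumes "finite D" "x \<notin> D"
  shows "sum f (Pow (insert x D)) = (\<Sum>S\<in>Pow D. f S + f (insert x S))"
proof -
  have "inj_on (insert x) (Pow D)"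
    using assms by (auto simp: inj_on_def)
  moreover have "Pow D \<inter> insert x ` Pow D = {}"
    using assms by auto
  ultimately show ?thesis
    using assms by (simp add: Pow_insert sum.union_disjoint sum.reindex sum.distrib)
qed

text \<open>
  The Ahlswede-Daykin theorem on a finite Boolean lattice. Summing each function over the two
  choices for a single element preserves the hypothesis, by the two-point case, so the ground set
  can be removed one element at a time.
\<close>

lemma four_functions:
  fixes \<alpha> \<beta> \<gamma> \<delta> :: "'a set \<Rightarrow> real"
  assumes "finite D"
    and "\<And>S. 0 \<le> \<alpha> S" "\<And>S. 0 \<le> \<beta> S" "\<And>S. 0 \<le> \<gamma> S" "\<And>S. 0 \<le> \<delta> S"
    and "\<And>S T. S \<subseteq> D \<Longrightarrow> T \<subseteq> D \<Longrightarrow> \<alpha> S * \<beta> T \<le> \<gamma> (S \<union> T) * \<delta> (S \<inter> T)"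
  shows "sum \<alpha> (Pow D) * sum \<beta> (Pow D) \<le> sum \<gamma> (Pow D) * sum \<delta> (Pow D)"
  using assms
proof (induction D arbitrary: \<alpha> \<beta> \<gamma> \<delta> rule: finite_induct)
  case empty
  from empty(5)[of "{}" "{}"] show ?case by simp
next
  case (insert x D)
  let ?fold = "\<lambda>f S. f S + f (insert x S) :: real"
  have "sum (?fold \<alpha>) (Pow D) * sum (?fold \<beta>) (Pow D) \<le> sum (?fold \<gamma>) (Pow D) * sum (?fold \<delta>) (Pow D)"
  proof (rule insert.IH)
    fix S T assume ST: "S \<subseteq> D" "T \<subseteq> D"
    then have x: "x \<notin> S" "x \<notin> T" using insert.hyps by auto
    have sub: "S \<subseteq> insert x D" "T \<subseteq> insert x D" "insert x S \<subseteq> insert x D" "insert x T \<subseteq> insert x D"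
      using ST by auto
    show "?fold \<alpha> S * ?fold \<beta> T \<le> ?fold \<gamma> (S \<union> T) * ?fold \<delta> (S \<inter> T)"
      using insert.prems(5)[OF sub(1) sub(2)] insert.prems(5)[OF sub(3) sub(4)]
        insert.prems(5)[OF sub(1) sub(4)] insert.prems(5)[OF sub(3) sub(2)] x
      by (intro four_functions_two_points insert.prems(1-4)) (simp_all add: Int_insert_right Int_insert_left)
  qed (use insert.prems in auto)
  then show ?case
    using insert.hyps by (simp add: sum_Pow_insert)
qed

section \<open>Tableaux as fillings of the quadrant\<close>

type_synonym filling = "nat \<times> nat \<Rightarrow> enat"

definition cells :: "filling \<Rightarrow> (nat \<times> nat) set"
  where "cells t = {x. t x \<noteq> \<infinity>}"

text \<open>
  The strictness condition on columns is required where the lower entry is finite; it then also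
  makes the upper entry finite, so that \<open>cells\<close> is a Young diagram. The value \<open>\<infinity>\<close> outside
  the diagram makes minimum and maximum of fillings act correctly on the diagrams as well.
\<close>

definition ssyt :: "filling \<Rightarrow> bool"
  where "ssyt t \<longleftrightarrow> finite (cells t) \<and>
    (\<forall>i j j'. j \<le> j' \<longrightarrow> t (i, j) \<le> t (i, j')) \<and>
    (\<forall>i i' j. i < i' \<and> t (i', j) \<noteq> \<infinity> \<longrightarrow> t (i, j) < t (i', j))"

definition shape :: "filling \<Rightarrow> partition"
  where "shape t = Abs_partition (\<lambda>i. card {j. (i, j) \<in> cells t})"

definition entry_monomial :: "enat \<Rightarrow> monomial"
  where "entry_monomial e = (case e of enat k \<Rightarrow> Poly_Mapping.single k 1 | \<infinity> \<Rightarrow> 0)"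

definition content :: "filling \<Rightarrow> monomial"
  where "content t = (\<Sum>x\<in>cells t. entry_monomial (t x))"

lemma ssyt_row: "ssyt t \<Longrightarrow> j \<le> j' \<Longrightarrow> t (i, j) \<le> t (i, j')"
  by (simp add: ssyt_def)

lemma ssyt_column_strict: "ssyt t \<Longrightarrow> i < i' \<Longrightarrow> t (i', j) \<noteq> \<infinity> \<Longrightarrow> t (i, j) < t (i', j)"
  unfolding ssyt_def by blast

lemma ssyt_column: "ssyt t \<Longrightarrow> i \<le> i' \<Longrightarrow> t (i, j) \<le> t (i', j)"
  unfolding ssyt_def by (metis enat_ord_code(3) order_le_less)

lemma ssyt_corner: "ssyt t \<Longrightarrow> t (0, 0) \<le> t (i, j)"
  using ssyt_row[of t 0 j 0] ssyt_column[of t 0 i j] by simp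

lemma cells_down_closed:
  assumes "ssyt t" "(i', j') \<in> cells t" "i \<le> i'" "j \<le> j'"
  shows "(i, j) \<in> cells t"
proof -
  have "t (i, j) \<le> t (i', j')"
    using ssyt_row[OF assms(1,4), of i] ssyt_column[OF assms(1,3), of j'] by (rule order_trans)
  then show ?thesis
    using assms(2) by (auto simp: cells_def dest: enat_ile)
qed

lemma down_closed_eq_lessThan:
  fixes A :: "nat set"
  assumes "finite A" and down: "\<And>x y. x \<in> A \<Longrightarrow> y \<le> x \<Longrightarrow> y \<in> A"
  shows "A = {..<card A}"
proof -
  have "\<exists>n. A = {..<n}"
  proof (cases "A = {}")
    case False
    have "A = {..Max A}"
      using Max_ge[OF \<open>finite A\<close>] down[OF Max_in[OF \<open>finite A\<close> False]] by blast
    then have "A = {..<Suc (Max A)}"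
      by (simp only: lessThan_Suc_atMost)
    then show ?thesis ..
  qed (auto intro: exI[of _ 0])
  then show ?thesis by (metis card_lessThan)
qed

lemma ssyt_row_lessThan:
  assumes "ssyt t"
  shows "{j. (i, j) \<in> cells t} = {..<card {j. (i, j) \<in> cells t}}"
proof (rule down_closed_eq_lessThan)
  have "finite (Pair i -` cells t)"
    using assms by (intro finite_vimageI) (auto simp: ssyt_def inj_on_def)
  then show "finite {j. (i, j) \<in> cells t}"
    by (simp add: vimage_def)
  show "y \<in> {j. (i, j) \<in> cells t}" if "x \<in> {j. (i, j) \<in> cells t}" "y \<le> x" for x y
    using cells_down_closed[OF assms, of i x i y] that by simp
qed

lemma part_shape:
  assumes "ssyt t"
  shows "part (shape t) i = card {j. (i, j) \<in> cells t}"
proof -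
  let ?f = "\<lambda>i. card {j. (i, j) \<in> cells t}"
  have fin: "finite {j. (i, j) \<in> cells t}" for i
    by (subst ssyt_row_lessThan[OF assms]) simp
  have "antimono ?f"
    by (intro antimonoI card_mono fin) (auto intro: cells_down_closed[OF assms])
  moreover have "{i. ?f i \<noteq> 0} \<subseteq> fst ` cells t"
  proof
    fix i assume "i \<in> {i. ?f i \<noteq> 0}"
    then have "{j. (i, j) \<in> cells t} \<noteq> {}" by (auto simp: card_eq_0_iff)
    then obtain j where "(i, j) \<in> cells t" by blast
    then show "i \<in> fst ` cells t" by (auto intro: rev_image_eqI)
  qed
  then have "finite {i. ?f i \<noteq> 0}"
    using assms by (auto simp: ssyt_def intro: finite_subset)
  ultimately show ?thesis
    by (simp add: shape_def Abs_partition_inverse)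
qed

lemma diagram_shape:
  assumes "ssyt t"
  shows "diagram (shape t) = cells t"
proof -
  have "j < card {j. (i, j) \<in> cells t} \<longleftrightarrow> (i, j) \<in> cells t" for i j
    using eqset_imp_iff[OF ssyt_row_lessThan[OF assms, of i], of j] by simp
  then show ?thesis
    by (auto simp: diagram_def part_shape[OF assms])
qed

lemma diagram_inject: "diagram p = diagram q \<longleftrightarrow> p = q"
proof
  assume eq: "diagram p = diagram q"
  have "{..<part p i} = {..<part q i}" for i
    using eq by (auto simp: diagram_def set_eq_iff)
  then show "p = q"
    by (simp add: part_inject[symmetric] fun_eq_iff)
qed simp

lemma shape_eqI: "ssyt t \<Longrightarrow> cells t = diagram p \<Longrightarrow> shape t = p"
  by (simp add: diagram_shape diagram_inject[symmetric])

lemma diagram_sup: "diagram (sup p q) = diagram p \<union> diagram q"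
  by (auto simp: diagram_def sup_partition.rep_eq)

lemma diagram_inf: "diagram (inf p q) = diagram p \<inter> diagram q"
  by (auto simp: diagram_def inf_partition.rep_eq)

lemma diagram_mono: "p \<le> q \<Longrightarrow> diagram p \<subseteq> diagram q"
  by (metis Un_upper1 diagram_sup sup_absorb2)

definition extend :: "partition \<Rightarrow> (nat \<times> nat \<Rightarrow> nat) \<Rightarrow> filling"
  where "extend p T x = (if x \<in> diagram p then enat (T x) else \<infinity>)"

lemma cells_extend: "cells (extend p T) = diagram p"
  by (auto simp: cells_def extend_def)

lemma diagram_down_closed: "(i', j') \<in> diagram p \<Longrightarrow> i \<le> i' \<Longrightarrow> j \<le> j' \<Longrightarrow> (i, j) \<in> diagram p"
  using part_antimono[of i i' p] by (auto simp: diagram_def)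

lemma ssyt_extend:
  assumes "\<And>i j j'. (i, j') \<in> diagram p \<Longrightarrow> j \<le> j' \<Longrightarrow> T (i, j) \<le> T (i, j')"
    and "\<And>i i' j. (i', j) \<in> diagram p \<Longrightarrow> i < i' \<Longrightarrow> T (i, j) < T (i', j)"
  shows "ssyt (extend p T)"
  using assms diagram_down_closed[of _ _ p]
  by (auto simp: ssyt_def cells_extend finite_diagram) (auto simp: extend_def split: if_splits intro: less_imp_le)

lemma content_extend: "content (extend p T) = weight p T"
  unfolding content_def weight_def cells_extend
  by (rule sum.cong) (auto simp: extend_def entry_monomial_def)

lemma shape_extend: "ssyt (extend p T) \<Longrightarrow> shape (extend p T) = p"
  by (simp add: shape_eqI cells_extend)

text \<open>
  Filling up with \<open>\<infinity>\<close> identifies the semistandard tableaux of shape \<open>p\<close> with the semistandard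
  fillings of that shape.
\<close>

lemma schur_eq_card_fillings: "schur p m = real (card {t. ssyt t \<and> shape t = p \<and> content t = m})"
proof -
  have "bij_betw (extend p) {T. semistandard p T \<and> weight p T = m}
     {t. ssyt t \<and> shape t = p \<and> content t = m}"
  proof (rule bij_betwI')
    fix S T assume "S \<in> {T. semistandard p T \<and> weight p T = m}" "T \<in> {T. semistandard p T \<and> weight p T = m}"
    then have zero: "\<And>x. x \<notin> diagram p \<Longrightarrow> S x = 0" "\<And>x. x \<notin> diagram p \<Longrightarrow> T x = 0"
      by (auto simp: semistandard_def)
    have "S x = T x" if "extend p S = extend p T" for x
      using fun_cong[OF that, of x] zero[of x] by (auto simp: extend_def split: if_splits)
    then show "extend p S = extend p T \<longleftrightarrow> S = T"
      by auto
  next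
    fix T assume T: "T \<in> {T. semistandard p T \<and> weight p T = m}"
    then have "T (i, j) \<le> T (i, j')" if "(i, j') \<in> diagram p" "j \<le> j'" for i j j'
      using that by (cases "j = j'") (auto simp: semistandard_def)
    then have "ssyt (extend p T)"
      using T by (intro ssyt_extend) (auto simp: semistandard_def)
    then show "extend p T \<in> {t. ssyt t \<and> shape t = p \<and> content t = m}"
      using T by (auto simp: content_extend shape_extend)
  next
    fix t assume "t \<in> {t. ssyt t \<and> shape t = p \<and> content t = m}"
    then have t: "ssyt t" "shape t = p" "content t = m" by auto
    then have cells: "cells t = diagram p" using diagram_shape by blast
    define T where "T x = (if x \<in> diagram p then the_enat (t x) else 0)" for x
    have "extend p T x = t x" for x
      using eqset_imp_iff[OF cells, of x] by (cases "t x") (simp_all add: extend_def T_def cells_def)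
    then have ext: "extend p T = t"
      by (rule ext)
    have fin: "t x = enat (T x)" if "x \<in> diagram p" for x
      using fun_cong[OF ext, of x] that by (simp add: extend_def)
    have "semistandard p T"
      unfolding semistandard_def
    proof (intro conjI allI impI)
      fix i j j' assume "j < j' \<and> (i, j') \<in> diagram p"
      then show "T (i, j) \<le> T (i, j')"
        using ssyt_row[OF t(1), of j j' i] fin diagram_down_closed[of i j' p i j] by simp
    next
      fix i i' j assume "i < i' \<and> (i', j) \<in> diagram p"
      then show "T (i, j) < T (i', j)"
        using ssyt_column_strict[OF t(1), of i i' j] fin diagram_down_closed[of i' j p i j] by simp
    qed (simp add: T_def)
    then show "\<exists>T\<in>{T. semistandard p T \<and> weight p T = m}. t = extend p T"
      using t ext content_extend[of p T] by (intro bexI[of _ T]) auto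
  qed
  then show ?thesis
    by (simp add: schur_def bij_betw_same_card)
qed

lemma content_eq_weight:
  assumes "ssyt t"
  shows "content t = weight (shape t) (\<lambda>x. the_enat (t x))"
  unfolding content_def weight_def diagram_shape[OF assms]
  by (rule sum.cong) (auto simp: entry_monomial_def cells_def)

text \<open>
  The content determines the number of cells, which leaves finitely many diagrams, and also
  the set of values that an entry can take.
\<close>

lemma finite_ssyt_content: "finite {t. ssyt t \<and> content t = m}"
proof -
  let ?n = "\<Sum>k\<in>Poly_Mapping.keys m. Poly_Mapping.lookup m k"
  let ?B = "\<Union>p\<in>{p. card (diagram p) = ?n}. {T. semistandard p T \<and> weight p T = m}"
  let ?C = "\<lambda>p. {t. \<forall>x. (x \<in> diagram p \<longrightarrow> t x \<in> enat ` Poly_Mapping.keys m) \<and> (x \<notin> diagram p \<longrightarrow> t x = \<infinity>)}"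
  have "t \<in> (\<Union>p\<in>{p. card (diagram p) = ?n}. ?C p)" if t: "ssyt t" "content t = m" for t
  proof (intro UN_I CollectI allI conjI impI)
    let ?T = "\<lambda>x. the_enat (t x)"
    have m: "m = weight (shape t) ?T"
      using content_eq_weight t by simp
    show "card (diagram (shape t)) = ?n"
      unfolding m by (rule sum_lookup_weight[symmetric])
    fix x
    show "t x = \<infinity>" if "x \<notin> diagram (shape t)"
      using that t by (simp add: diagram_shape cells_def)
    show "t x \<in> enat ` Poly_Mapping.keys m" if "x \<in> diagram (shape t)"
    proof (rule image_eqI)
      show "t x = enat (?T x)"
        using that t by (auto simp: diagram_shape cells_def)
      show "?T x \<in> Poly_Mapping.keys m"
        using that unfolding m keys_weight by (rule imageI)
    qed
  qed
  moreover have "finite (\<Union>p\<in>{p. card (diagram p) = ?n}. ?C p)"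
    by (intro finite_UN_I finite_partitions_of_size finite_set_of_finite_funs finite_diagram
        finite_imageI finite_keys)
  ultimately show ?thesis
    by (elim finite_subset[rotated]) auto
qed

lemma schur_series_eq_sum_ssyt: "schur_series a m = (\<Sum>t | ssyt t \<and> content t = m. a (shape t))"
proof -
  let ?S = "{t. ssyt t \<and> content t = m}"
  have "schur p m = real (card {t \<in> ?S. shape t = p})" for p
    unfolding schur_eq_card_fillings by (rule arg_cong[where f = "\<lambda>A. real (card A)"]) auto
  then have *: "a p * schur p m = (\<Sum>t\<in>{t \<in> ?S. shape t = p}. a (shape t))" for p
    by (simp add: mult.commute)
  have "schur_series a m = (\<Sum>p\<in>shape ` ?S. a p * schur p m)"
    unfolding schur_series_def
  proof (rule Sum_any.expand_superset)
    show "finite (shape ` ?S)"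
      by (intro finite_imageI finite_ssyt_content)
    show "{p. a p * schur p m \<noteq> 0} \<subseteq> shape ` ?S"
    proof
      fix p assume "p \<in> {p. a p * schur p m \<noteq> 0}"
      then have "{t \<in> ?S. shape t = p} \<noteq> {}"
        using * by (metis (mono_tags, lifting) mem_Collect_eq sum.empty)
      then show "p \<in> shape ` ?S" by blast
    qed
  qed
  also have "\<dots> = (\<Sum>p\<in>shape ` ?S. \<Sum>t\<in>{t \<in> ?S. shape t = p}. a (shape t))"
    by (simp only: *)
  also have "\<dots> = (\<Sum>t\<in>?S. a (shape t))"
    by (rule sum.image_gen[symmetric]) (rule finite_ssyt_content)
  finally show ?thesis .
qed

definition ssyt_pairs :: "monomial \<Rightarrow> (filling \<times> filling) set"
  where "ssyt_pairs m = {(t, u). ssyt t \<and> ssyt u \<and> content t + content u = m}"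

lemma ssyt_pairs_eq_Sigma:
  "ssyt_pairs m = (\<lambda>(_, z). z) ` (SIGMA (v, w):{(v, w). v + w = m}.
     {t. ssyt t \<and> content t = v} \<times> {u. ssyt u \<and> content u = w})"
  by (force simp: ssyt_pairs_def)

lemma finite_ssyt_pairs: "finite (ssyt_pairs m)"
  unfolding ssyt_pairs_eq_Sigma
  by (intro finite_imageI finite_SigmaI finite_monomial_splits) (auto intro: finite_ssyt_content)

lemma ps_mult_schur_series:
  "(schur_series a \<odot> schur_series b) m = (\<Sum>(t, u)\<in>ssyt_pairs m. a (shape t) * b (shape u))"
proof -
  let ?V = "{(v, w). v + w = m}"
  let ?S = "\<lambda>v. {t. ssyt t \<and> content t = v}"
  let ?c = "\<lambda>(t, u). (content t, content u)"
  have fibre: "{z \<in> ssyt_pairs m. ?c z = (v, w)} = ?S v \<times> ?S w" if "v + w = m" for v w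
    using that by (auto simp: ssyt_pairs_def)
  have "(schur_series a \<odot> schur_series b) m =
      (\<Sum>(v, w)\<in>?V. \<Sum>(t, u)\<in>?S v \<times> ?S w. a (shape t) * b (shape u))"
    unfolding ps_mult_def schur_series_eq_sum_ssyt sum_product sum.cartesian_product by simp
  also have "\<dots> = (\<Sum>vw\<in>?V. \<Sum>(t, u)\<in>{z \<in> ssyt_pairs m. ?c z = vw}. a (shape t) * b (shape u))"
  proof (rule sum.cong[OF refl])
    fix vw assume "vw \<in> ?V"
    then obtain v w where vw: "vw = (v, w)" "v + w = m" by auto
    show "(case vw of (v, w) \<Rightarrow> \<Sum>(t, u)\<in>?S v \<times> ?S w. a (shape t) * b (shape u)) =
        (\<Sum>(t, u)\<in>{z \<in> ssyt_pairs m. ?c z = vw}. a (shape t) * b (shape u))"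
      unfolding vw(1) fibre[OF vw(2)] by simp
  qed
  also have "\<dots> = (\<Sum>(t, u)\<in>ssyt_pairs m. a (shape t) * b (shape u))"
    by (rule sum.group[OF finite_ssyt_pairs finite_monomial_splits]) (auto simp: ssyt_pairs_def)
  finally show ?thesis .
qed

lemma cells_inf: "cells (inf t u) = cells t \<union> cells u"
proof -
  have "min (t x) (u x) = \<infinity> \<longleftrightarrow> t x = \<infinity> \<and> u x = \<infinity>" for x
    by (cases "t x"; cases "u x") (simp_all add: min_def)
  then show ?thesis
    by (simp only: cells_def inf_apply inf_min de_Morgan_conj Collect_disj_eq)
qed

lemma cells_sup: "cells (sup t u) = cells t \<inter> cells u"
proof -
  have "max (t x) (u x) = \<infinity> \<longleftrightarrow> t x = \<infinity> \<or> u x = \<infinity>" for x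
    by (cases "t x"; cases "u x") (simp_all add: max_def)
  then show ?thesis
    by (simp only: cells_def sup_apply sup_max de_Morgan_disj Collect_conj_eq)
qed

lemma ssyt_inf:
  assumes "ssyt t" "ssyt u"
  shows "ssyt (inf t u)"
  unfolding ssyt_def cells_inf
proof (intro conjI allI impI)
  show "finite (cells t \<union> cells u)"
    using assms by (simp add: ssyt_def)
  show "inf t u (i, j) \<le> inf t u (i, j')" if "j \<le> j'" for i j j'
    unfolding inf_apply by (intro inf_mono ssyt_row that assms)
  show "inf t u (i, j) < inf t u (i', j)" if "i < i' \<and> inf t u (i', j) \<noteq> \<infinity>" for i i' j
    using that ssyt_column_strict[OF assms(1), of i i' j] ssyt_column_strict[OF assms(2), of i i' j]
    unfolding inf_apply inf_min
    by (cases "t (i', j)"; cases "u (i', j)"; cases "t (i', j) \<le> u (i', j)") (auto simp: min_less_iff_disj max_def min_def)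
qed

lemma ssyt_sup:
  assumes "ssyt t" "ssyt u"
  shows "ssyt (sup t u)"
  unfolding ssyt_def cells_sup
proof (intro conjI allI impI)
  show "finite (cells t \<inter> cells u)"
    using assms by (simp add: ssyt_def)
  show "sup t u (i, j) \<le> sup t u (i, j')" if "j \<le> j'" for i j j'
    unfolding sup_apply by (intro sup_mono ssyt_row that assms)
  show "sup t u (i, j) < sup t u (i', j)" if "i < i' \<and> sup t u (i', j) \<noteq> \<infinity>" for i i' j
  proof -
    have "(i', j) \<in> cells (sup t u)"
      using that by (simp add: cells_def)
    then have "t (i', j) \<noteq> \<infinity>" "u (i', j) \<noteq> \<infinity>"
      unfolding cells_sup by (simp_all add: cells_def)
    then have "t (i, j) < t (i', j)" "u (i, j) < u (i', j)"
      using that ssyt_column_strict assms by blast+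
    then have "t (i, j) < max (t (i', j)) (u (i', j))" "u (i, j) < max (t (i', j)) (u (i', j))"
      by (simp_all add: less_max_iff_disj)
    then show ?thesis
      by (simp add: sup_max)
  qed
qed

text \<open>
  Small entries mean large shapes: a cell is finite in the minimum exactly if it is finite in
  one of the two fillings.
\<close>

lemma shape_inf: "ssyt t \<Longrightarrow> ssyt u \<Longrightarrow> shape (inf t u) = sup (shape t) (shape u)"
  by (simp add: shape_eqI ssyt_inf cells_inf diagram_sup diagram_shape)

lemma shape_sup: "ssyt t \<Longrightarrow> ssyt u \<Longrightarrow> shape (sup t u) = inf (shape t) (shape u)"
  by (simp add: shape_eqI ssyt_sup cells_sup diagram_inf diagram_shape)

text \<open>
  At each cell minimum and maximum are the two given entries in some order.
\<close>

lemma content_inf_sup: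
  assumes "ssyt t" "ssyt u"
  shows "content (inf t u) + content (sup t u) = content t + content u"
proof -
  let ?A = "cells t \<union> cells u"
  have fin: "finite ?A" using assms by (simp add: ssyt_def)
  have "content s = (\<Sum>x\<in>?A. entry_monomial (s x))" if "cells s \<subseteq> ?A" for s
    unfolding content_def
    by (rule sum.mono_neutral_left[OF fin that]) (auto simp: cells_def entry_monomial_def)
  then have *: "content s + content s' = (\<Sum>x\<in>?A. entry_monomial (s x) + entry_monomial (s' x))"
    if "cells s \<subseteq> ?A" "cells s' \<subseteq> ?A" for s s'
    using that by (simp add: sum.distrib)
  have "content (inf t u) + content (sup t u) =
      (\<Sum>x\<in>?A. entry_monomial (inf t u x) + entry_monomial (sup t u x))"
    by (rule *) (auto simp: cells_inf cells_sup)
  also have "\<dots> = (\<Sum>x\<in>?A. entry_monomial (t x) + entry_monomial (u x))"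
    by (rule sum.cong) (auto simp: inf_min sup_max min_def max_def add.commute)
  also have "\<dots> = content t + content u"
    by (rule *[symmetric]) auto
  finally show ?thesis .
qed

section \<open>Exchanging entries between two tableaux\<close>

definition exchanges :: "filling \<Rightarrow> filling \<Rightarrow> (filling \<times> filling) set"
  where "exchanges P Q = {(t, u). ssyt t \<and> ssyt u \<and> inf t u = P \<and> sup t u = Q}"

abbreviation pair_sum :: "(partition \<Rightarrow> real) \<Rightarrow> (partition \<Rightarrow> real) \<Rightarrow> (filling \<times> filling) set \<Rightarrow> real"
  where "pair_sum a b X \<equiv> \<Sum>(t, u)\<in>X. a (shape t) * b (shape u)"

lemma exchanges_subset: "exchanges P Q \<subseteq> ssyt_pairs (content P + content Q)"
  by (auto simp: exchanges_def ssyt_pairs_def content_inf_sup)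

lemma finite_exchanges: "finite (exchanges P Q)"
  using exchanges_subset finite_ssyt_pairs by (rule finite_subset)

text \<open>
  Every member of the fibre over \<open>(P, Q)\<close> has the form \<open>switch P Q S\<close> in its first component, and
  the complementary switch in the second.
\<close>

definition switch :: "filling \<Rightarrow> filling \<Rightarrow> (nat \<times> nat) set \<Rightarrow> filling"
  where "switch P Q S x = (if x \<in> S then P x else Q x)"

lemma min_max_cases:
  fixes t u v w :: "'a::linorder"
  assumes "min t u = v" "max t u = w"
  shows "t = v \<and> u = w \<or> t = w \<and> u = v"
  using assms by (auto simp: min_def max_def split: if_splits)

lemma exchanges_pointwise:
  assumes "inf t u = P" "sup t u = (Q :: filling)"
  shows "t x = P x \<and> u x = Q x \<or> t x = Q x \<and> u x = P x"
proof (rule min_max_cases)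
  show "min (t x) (u x) = P x" "max (t x) (u x) = Q x"
    unfolding assms[symmetric] by (simp_all add: inf_min sup_max)
qed

text \<open>
  For \<open>P \<le> Q\<close> the switches form a Boolean lattice that is turned upside down: taking \<open>P\<close> on more
  cells makes the entries smaller and the shape larger.
\<close>

lemma switch_union:
  assumes "P \<le> Q"
  shows "switch P Q (S \<union> T) = inf (switch P Q S) (switch P Q T)"
  using le_funD[OF assms] by (auto simp: fun_eq_iff switch_def inf_absorb1 inf_absorb2)

lemma switch_inter:
  assumes "P \<le> Q"
  shows "switch P Q (S \<inter> T) = sup (switch P Q S) (switch P Q T)"
  using le_funD[OF assms] by (auto simp: fun_eq_iff switch_def sup_absorb1 sup_absorb2)

text \<open>
  At each cell the two entries of a pair in the fibre are those of \<open>P\<close> and \<open>Q\<close> in some order, so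
  the pair is determined by the set where its first component agrees with \<open>P\<close>.
\<close>

lemma bij_betw_switch:
  assumes "P \<le> Q"
  defines "D \<equiv> {x. P x \<noteq> Q x}"
  shows "bij_betw (\<lambda>S. (switch P Q S, switch P Q (D - S)))
    {S \<in> Pow D. ssyt (switch P Q S) \<and> ssyt (switch P Q (D - S))} (exchanges P Q)"
proof (rule bij_betwI')
  fix S T assume "S \<in> {S \<in> Pow D. ssyt (switch P Q S) \<and> ssyt (switch P Q (D - S))}"
    "T \<in> {S \<in> Pow D. ssyt (switch P Q S) \<and> ssyt (switch P Q (D - S))}"
  then have sub: "S \<subseteq> D" "T \<subseteq> D" by auto
  have "x \<in> S \<longleftrightarrow> x \<in> T" if "switch P Q S = switch P Q T" for x
    using fun_cong[OF that, of x] sub by (auto simp: switch_def D_def split: if_splits)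
  then show "(switch P Q S, switch P Q (D - S)) = (switch P Q T, switch P Q (D - T)) \<longleftrightarrow> S = T"
    by auto
next
  fix S assume S: "S \<in> {S \<in> Pow D. ssyt (switch P Q S) \<and> ssyt (switch P Q (D - S))}"
  have "switch P Q D = P" "switch P Q {} = Q"
    by (auto simp: switch_def D_def fun_eq_iff)
  moreover have "S \<union> (D - S) = D" "S \<inter> (D - S) = {}"
    using S by auto
  ultimately show "(switch P Q S, switch P Q (D - S)) \<in> exchanges P Q"
    using S switch_union[OF assms(1), of S "D - S"] switch_inter[OF assms(1), of S "D - S"]
    by (simp add: exchanges_def)
next
  fix z assume "z \<in> exchanges P Q"
  then obtain t u where z: "z = (t, u)" and ssyt: "ssyt t" "ssyt u" and tu: "inf t u = P" "sup t u = Q"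
    by (auto simp: exchanges_def)
  note cases = exchanges_pointwise[OF tu]
  define S where "S = {x \<in> D. t x = P x}"
  have "switch P Q S x = t x" for x
    using cases[of x] by (auto simp: switch_def D_def S_def)
  moreover have "switch P Q (D - S) x = u x" for x
    using cases[of x] by (auto simp: switch_def D_def S_def)
  ultimately have "switch P Q S = t" "switch P Q (D - S) = u"
    by (simp_all add: fun_eq_iff)
  moreover have "S \<subseteq> D"
    by (auto simp: S_def)
  ultimately show "\<exists>S\<in>{S \<in> Pow D. ssyt (switch P Q S) \<and> ssyt (switch P Q (D - S))}.
      z = (switch P Q S, switch P Q (D - S))"
    using ssyt z by (intro bexI[of _ S]) simp_all
qed

text \<open>
  The four functions theorem is applied to a function \<open>F\<close> of \<open>S\<close> and to its composition with
  the complement. Its hypothesis is a product of two instances of \<open>le\<close>: of the four fillings that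
  enter \<open>F a b S\<close> and \<open>F a b (D - T)\<close>, the first components combine with second components of the
  other pair. Both sums that the theorem multiplies are then the same, so the conclusion is a
  comparison of squares.
\<close>

lemma exchange_inequality:
  assumes nonneg: "\<And>p. 0 \<le> a p" "\<And>p. 0 \<le> b p" "\<And>p. 0 \<le> c p" "\<And>p. 0 \<le> d p"
    and le: "\<And>p q. a p * b q \<le> c (sup p q) * d (inf p q)"
  shows "pair_sum a b (exchanges P Q) \<le> pair_sum c d (exchanges P Q)"
proof (cases "exchanges P Q = {}")
  case False
  then have "P \<le> Q" "ssyt P"
    by (auto simp: exchanges_def ssyt_inf le_supI1)
  define D where "D = {x. P x \<noteq> Q x}"
  let ?s = "switch P Q"
  define valid where "valid S \<longleftrightarrow> ssyt (?s S) \<and> ssyt (?s (D - S))" for S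
  \<comment> \<open>The sets with a switch that is not semistandard get the value 0. This keeps the hypothesis of
    the four functions theorem, since the remaining sets are closed under union,
    intersection and complement.\<close>
  define F :: "(partition \<Rightarrow> real) \<Rightarrow> (partition \<Rightarrow> real) \<Rightarrow> (nat \<times> nat) set \<Rightarrow> real"
    where "F f g S = (if valid S then f (shape (?s S)) * g (shape (?s (D - S))) else 0)" for f g S
  have "D \<subseteq> cells P"
  proof
    fix x assume "x \<in> D"
    then show "x \<in> cells P"
      using le_funD[OF \<open>P \<le> Q\<close>, of x] by (cases "P x") (auto simp: D_def cells_def)
  qed
  then have "finite D"
    using \<open>ssyt P\<close> by (auto simp: ssyt_def intro: finite_subset)
  have pair_sum_F: "pair_sum f g (exchanges P Q) = sum (F f g) (Pow D)" for f g
  proof -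
    have "pair_sum f g (exchanges P Q) =
        (\<Sum>S | S \<in> Pow D \<and> valid S. f (shape (?s S)) * g (shape (?s (D - S))))"
      using sum.reindex_bij_betw[OF bij_betw_switch[OF \<open>P \<le> Q\<close>],
          of "\<lambda>(t, u). f (shape t) * g (shape u)"]
      by (simp add: D_def valid_def)
    also have "\<dots> = sum (F f g) (Pow D)"
      using \<open>finite D\<close> unfolding F_def by (intro sum.inter_filter) simp
    finally show ?thesis .
  qed
  have F_nonneg: "0 \<le> F a b S" "0 \<le> F c d S" for S
    using nonneg by (simp_all add: F_def)
  have complement_sum: "(\<Sum>S\<in>Pow D. h (D - S)) = sum h (Pow D)" for h :: "(nat \<times> nat) set \<Rightarrow> real"
    by (rule sum.reindex_bij_witness[of _ "\<lambda>S. D - S" "\<lambda>S. D - S"]) auto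
  have "sum (F a b) (Pow D) * (\<Sum>S\<in>Pow D. F a b (D - S)) \<le> sum (F c d) (Pow D) * (\<Sum>S\<in>Pow D. F c d (D - S))"
  proof (rule four_functions[OF \<open>finite D\<close>])
    fix S T assume sub: "S \<subseteq> D" "T \<subseteq> D"
    show "F a b S * F a b (D - T) \<le> F c d (S \<union> T) * F c d (D - S \<inter> T)"
    proof (cases "valid S \<and> valid (D - T)")
      case False
      then have "F a b S * F a b (D - T) = 0" by (auto simp: F_def)
      also have "0 \<le> F c d (S \<union> T) * F c d (D - S \<inter> T)"
        by (intro mult_nonneg_nonneg F_nonneg)
      finally show ?thesis .
    next
      case True
      define s s' t t' where "s = ?s S" "s' = ?s (D - S)" "t = ?s T" "t' = ?s (D - T)"
      note defs = this
      have compl: "D - (D - T) = T" "D - (D - S \<inter> T) = S \<inter> T"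
        "D - (S \<union> T) = (D - S) \<inter> (D - T)" "D - S \<inter> T = (D - S) \<union> (D - T)"
        using sub by auto
      have ssyt: "ssyt s" "ssyt s'" "ssyt t" "ssyt t'"
        using True by (auto simp: defs valid_def compl)
      have merge: "?s (S \<union> T) = inf s t" "?s (S \<inter> T) = sup s t"
        "?s (D - (S \<union> T)) = sup s' t'" "?s (D - S \<inter> T) = inf s' t'"
        unfolding compl(3,4) by (simp_all add: defs switch_union switch_inter \<open>P \<le> Q\<close>)
      then have valid: "valid (S \<union> T)" "valid (D - S \<inter> T)"
        using ssyt by (simp_all add: valid_def compl(2) ssyt_inf ssyt_sup)
      \<comment> \<open>The factors are regrouped so that \<open>s\<close> meets \<open>t\<close>, and \<open>t'\<close> meets \<open>s'\<close>.\<close>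
      have "F a b S * F a b (D - T) = (a (shape s) * b (shape t)) * (a (shape t') * b (shape s'))"
        using True by (simp add: F_def compl(1) defs mult_ac)
      also have "\<dots> \<le> (c (sup (shape s) (shape t)) * d (inf (shape s) (shape t))) *
          (c (sup (shape t') (shape s')) * d (inf (shape t') (shape s')))"
        using nonneg by (intro mult_mono le) simp_all
      also have "\<dots> = F c d (S \<union> T) * F c d (D - S \<inter> T)"
        using valid by (simp add: F_def merge compl(2) shape_inf shape_sup ssyt sup.commute inf.commute mult_ac)
      finally show ?thesis .
    qed
  qed (use F_nonneg in auto)
  then have "(sum (F a b) (Pow D))\<^sup>2 \<le> (sum (F c d) (Pow D))\<^sup>2"
    by (simp only: complement_sum power2_eq_square)
  then show ?thesis
    unfolding pair_sum_F by (rule power2_le_imp_le) (simp add: sum_nonneg F_nonneg)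
qed simp

lemma pair_sum_split_exchanges:
  "pair_sum a b (ssyt_pairs m) = (\<Sum>(P, Q)\<in>ssyt_pairs m. pair_sum a b (exchanges P Q))"
proof -
  let ?\<phi> = "\<lambda>(t, u). (inf t u, sup t u)"
  have "pair_sum a b (ssyt_pairs m) = (\<Sum>y\<in>ssyt_pairs m. pair_sum a b {z \<in> ssyt_pairs m. ?\<phi> z = y})"
    by (rule sum.group[OF finite_ssyt_pairs finite_ssyt_pairs, symmetric])
      (auto simp: ssyt_pairs_def ssyt_inf ssyt_sup content_inf_sup)
  also have "\<dots> = (\<Sum>(P, Q)\<in>ssyt_pairs m. pair_sum a b (exchanges P Q))"
  proof (rule sum.cong[OF refl], clarify)
    fix P Q assume PQ: "(P, Q) \<in> ssyt_pairs m"
    have "(t, u) \<in> ssyt_pairs m" if "(t, u) \<in> exchanges P Q" for t u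
      using exchanges_subset that PQ by (auto simp: ssyt_pairs_def)
    then have "{z \<in> ssyt_pairs m. ?\<phi> z = (P, Q)} = exchanges P Q"
      by (auto simp: exchanges_def ssyt_pairs_def)
    then show "pair_sum a b {z \<in> ssyt_pairs m. ?\<phi> z = (P, Q)} = pair_sum a b (exchanges P Q)"
      by (rule arg_cong)
  qed
  finally show ?thesis .
qed

text \<open>
  The products have equal coefficients at the monomial \<open>content P + content Q\<close>, and these
  are sums over fibres that satisfy an inequality term by term.
\<close>

lemma exchange_equality:
  assumes nonneg: "\<And>p. 0 \<le> a p" "\<And>p. 0 \<le> b p" "\<And>p. 0 \<le> c p" "\<And>p. 0 \<le> d p"
    and le: "\<And>p q. a p * b q \<le> c (sup p q) * d (inf p q)"
    and eq: "schur_series a \<odot> schur_series b = schur_series c \<odot> schur_series d"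
    and ssyt: "ssyt P" "ssyt Q"
  shows "pair_sum a b (exchanges P Q) = pair_sum c d (exchanges P Q)"
proof -
  let ?m = "content P + content Q"
  let ?f = "\<lambda>a b (P, Q). pair_sum a b (exchanges P Q)"
  have "?f a b (P, Q) = ?f c d (P, Q)"
  proof (rule sum_mono_inv[where I = "ssyt_pairs ?m"])
    show "sum (?f a b) (ssyt_pairs ?m) = sum (?f c d) (ssyt_pairs ?m)"
      using fun_cong[OF eq, of ?m]
      by (simp only: ps_mult_schur_series pair_sum_split_exchanges)
    show "?f a b y \<le> ?f c d y" for y
      using exchange_inequality[of a b c d, OF nonneg le] by (cases y) simp
  qed (use ssyt finite_ssyt_pairs in \<open>auto simp: ssyt_pairs_def\<close>)
  then show ?thesis by simp
qed

definition row_filling :: "nat \<Rightarrow> partition \<Rightarrow> filling"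
  where "row_filling N p = extend p (\<lambda>(i, j). N + i)"

lemma ssyt_row_filling: "ssyt (row_filling N p)"
  unfolding row_filling_def by (rule ssyt_extend) auto

lemma shape_row_filling: "shape (row_filling N p) = p"
  using ssyt_row_filling shape_extend by (simp add: row_filling_def)

text \<open>
  All finite entries of \<open>P\<close> are smaller than all entries of \<open>Q\<close>. A semistandard filling that has
  the entry of \<open>Q\<close> in the corner therefore cannot contain a finite entry of \<open>P\<close> anywhere: the
  corner ties all cells together, and only a total exchange is possible.
\<close>

lemma exchanges_linked:
  assumes "p \<le> q" and N: "\<And>i j. (i, j) \<in> diagram q \<Longrightarrow> i < N"
  defines "P \<equiv> row_filling 0 q" and "Q \<equiv> row_filling N p"
  shows "exchanges P Q = {(P, Q), (Q, P)}"
proof -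
  have "P x \<le> Q x" for x
    using diagram_mono[OF assms(1)]
    by (cases x) (auto simp: P_def Q_def row_filling_def extend_def)
  then have "P \<le> Q" by (simp add: le_fun_def)
  have link: "t = P \<and> u = Q"
    if "ssyt u" and tu: "inf t u = P" "sup t u = Q" and "u (0, 0) = Q (0, 0)" for t u
  proof -
    have "t (i, j) = P (i, j) \<and> u (i, j) = Q (i, j)" for i j
    proof (cases "(i, j) \<in> diagram q")
      case True
      have "P (i, j) < enat N"
        using N[OF True] True by (simp add: P_def row_filling_def extend_def)
      also have "\<dots> \<le> u (0, 0)"
        using that by (simp add: Q_def row_filling_def extend_def)
      also have "\<dots> \<le> u (i, j)"
        using \<open>ssyt u\<close> by (rule ssyt_corner)
      finally show ?thesis
        using exchanges_pointwise[OF tu, of "(i, j)"] by auto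
    next
      case False
      then have "P (i, j) = Q (i, j)"
        using diagram_mono[OF assms(1)] by (auto simp: P_def Q_def row_filling_def extend_def)
      then show ?thesis
        using exchanges_pointwise[OF tu, of "(i, j)"] by auto
    qed
    then show ?thesis by (auto simp: fun_eq_iff)
  qed
  show ?thesis
  proof (intro equalityI subsetI)
    fix z assume "z \<in> exchanges P Q"
    then obtain t u where z: "z = (t, u)" and tu: "ssyt t" "ssyt u" "inf t u = P" "sup t u = Q"
      by (auto simp: exchanges_def)
    then show "z \<in> {(P, Q), (Q, P)}"
      using exchanges_pointwise[OF tu(3,4), of "(0, 0)"] link[of u t] link[of t u]
      by (auto simp: inf.commute sup.commute)
  next
    fix z assume "z \<in> {(P, Q), (Q, P)}"
    then show "z \<in> exchanges P Q"
      using \<open>P \<le> Q\<close> ssyt_row_filling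
      by (auto simp: exchanges_def inf_absorb1 inf_absorb2 sup_absorb1 sup_absorb2 P_def Q_def)
  qed
qed

text \<open>
  This is the equality in the fibre \<open>{(P, Q), (Q, P)}\<close> of the preceding lemma. The two pairs
  coincide only if \<open>P = Q\<close>, which forces \<open>p = q\<close>; then the fibre contributes half of the identity.
\<close>

lemma comparable_identity:
  assumes eq: "\<And>P Q. ssyt P \<Longrightarrow> ssyt Q \<Longrightarrow> pair_sum a b (exchanges P Q) = pair_sum c d (exchanges P Q)"
    and "p \<le> q"
  shows "a p * b q + a q * b p = c p * d q + c q * d p"
proof -
  obtain N where N: "\<And>i j. (i, j) \<in> diagram q \<Longrightarrow> i < N"
    using finite_imageI[OF finite_diagram, of fst q] by (fastforce simp: finite_nat_set_iff_bounded)
  define P Q where PQ: "P = row_filling 0 q" "Q = row_filling N p"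
  have shapes: "shape P = q" "shape Q = p"
    by (simp_all add: PQ shape_row_filling)
  have "pair_sum a b {(P, Q), (Q, P)} = pair_sum c d {(P, Q), (Q, P)}"
    using eq[of P Q] exchanges_linked[OF \<open>p \<le> q\<close> N] by (simp add: PQ ssyt_row_filling)
  then show ?thesis
  proof (cases "P = Q")
    case True
    then have "p = q" using shapes by simp
    then show ?thesis
      using \<open>pair_sum a b _ = _\<close> True shapes by simp
  next
    case False
    then show ?thesis
      using \<open>pair_sum a b _ = _\<close> shapes by (simp add: add.commute)
  qed
qed

text \<open>
  Within a fibre the join and the meet of the two shapes are constant. If the bound
  \<open>c (sup p q) * d (inf p q)\<close> is zero, every term of \<open>a\<close> and \<open>b\<close> in the fibre vanishes, hence so
  does every term of \<open>c\<close> and \<open>d\<close>.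
\<close>

lemma vanishing_product:
  assumes nonneg: "\<And>p. 0 \<le> c p" "\<And>p. 0 \<le> d p"
    and le: "\<And>p q. a p * b q \<le> c (sup p q) * d (inf p q)"
    and eq: "\<And>P Q. ssyt P \<Longrightarrow> ssyt Q \<Longrightarrow> pair_sum a b (exchanges P Q) = pair_sum c d (exchanges P Q)"
    and zero: "c (sup p q) * d (inf p q) = 0"
  shows "c p * d q = 0"
proof -
  define t u where tu: "t = row_filling 0 p" "u = row_filling 0 q"
  have ssyt: "ssyt t" "ssyt u" and shapes: "shape t = p" "shape u = q"
    by (simp_all add: tu ssyt_row_filling shape_row_filling)
  let ?E = "exchanges (inf t u) (sup t u)"
  have "a (shape t') * b (shape u') \<le> 0" if "(t', u') \<in> ?E" for t' u'
  proof -
    have "sup (shape t') (shape u') = sup p q" "inf (shape t') (shape u') = inf p q"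
      using that ssyt shapes by (auto simp: exchanges_def shape_inf[symmetric] shape_sup[symmetric])
    then show ?thesis
      using le[of "shape t'" "shape u'"] zero by simp
  qed
  then have "pair_sum c d ?E \<le> 0"
    by (subst eq[symmetric]) (auto simp: ssyt ssyt_inf ssyt_sup intro!: sum_nonpos)
  moreover have "(t, u) \<in> ?E"
    using ssyt by (simp add: exchanges_def)
  then have "c p * d q \<le> pair_sum c d ?E"
    using member_le_sum[of "(t, u)" ?E "\<lambda>(t, u). c (shape t) * d (shape u)"] nonneg finite_exchanges
    by (auto simp: shapes)
  moreover have "0 \<le> c p * d q"
    using nonneg by simp
  ultimately show ?thesis by linarith
qed

section \<open>Polarized identities and proportionality\<close>

lemma parallel_trans:
  fixes x1 :: "'a::field"
  assumes "x1 \<noteq> 0 \<or> x2 \<noteq> 0" and "y1 * x2 = x1 * y2" and "z1 * x2 = x1 * z2"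
  shows "y1 * z2 = z1 * y2"
proof -
  have "x1 * (y1 * z2) = x1 * (z1 * y2)" "x2 * (y1 * z2) = x2 * (z1 * y2)"
    using assms(2,3) by algebra+
  then show ?thesis using assms(1) by auto
qed

lemma rank_one_factorization:
  fixes a b c d :: real
  assumes nonneg: "0 \<le> a" "0 \<le> b" "0 \<le> c" "0 \<le> d" and eq: "a * b = c * d"
  shows "\<exists>u1 u2 w1 w2. 0 \<le> u1 \<and> 0 \<le> u2 \<and> 0 \<le> w1 \<and> 0 \<le> w2 \<and>
    a = u1 * w1 \<and> b = u2 * w2 \<and> c = u1 * w2 \<and> d = u2 * w1"
proof (cases "a + c = 0")
  case True
  then have "a = 0" "c = 0" using nonneg by auto
  then show ?thesis
    using nonneg by (intro exI[of _ 0] exI[of _ 1] exI[of _ d] exI[of _ b]) auto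
next
  case False
  \<comment> \<open>The row is \<open>(a, c)\<close>. Taking the ratio of the row sums as the second entry of the column avoids
    a division by \<open>a\<close> or \<open>c\<close> alone.\<close>
  then have "(d + b) / (a + c) * c = b" "(d + b) / (a + c) * a = d"
    using eq by (simp_all add: field_simps)
  then show ?thesis
    using nonneg by (intro exI[of _ 1] exI[of _ "(d + b) / (a + c)"] exI[of _ a] exI[of _ c]) auto
qed

text \<open>
  The polar form of the determinant of two matrices of rank one is the product of the
  determinants of their columns and of their rows.
\<close>

lemma polarized_determinant:
  fixes u1 :: "'a::comm_ring_1"
  shows "(u1 * w1) * (u2' * w2') + (u1' * w1') * (u2 * w2) = (u1 * w2) * (u2' * w1') + (u1' * w2') * (u2 * w1)
     \<longleftrightarrow> (u1 * u2' - u1' * u2) * (w1 * w2' - w1' * w2) = 0"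
  by (auto simp: algebra_simps)

lemma rank_one_functions:
  fixes a b c d :: "'p \<Rightarrow> real"
  assumes "\<And>p. 0 \<le> a p" "\<And>p. 0 \<le> b p" "\<And>p. 0 \<le> c p" "\<And>p. 0 \<le> d p"
    and "\<And>p. a p * b p = c p * d p"
  shows "\<exists>u1 u2 w1 w2. (\<forall>p. 0 \<le> u1 p \<and> 0 \<le> u2 p \<and> 0 \<le> w1 p \<and> 0 \<le> w2 p) \<and>
    (\<forall>p. a p = u1 p * w1 p \<and> b p = u2 p * w2 p \<and> c p = u1 p * w2 p \<and> d p = u2 p * w1 p) \<and>
    (\<forall>p q. a p * b q + a q * b p = c p * d q + c q * d p \<longleftrightarrow>
       u1 p * u2 q = u1 q * u2 p \<or> w1 p * w2 q = w1 q * w2 p)"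
proof -
  have "\<forall>p. \<exists>u1 u2 w1 w2. 0 \<le> u1 \<and> 0 \<le> u2 \<and> 0 \<le> w1 \<and> 0 \<le> w2 \<and>
    a p = u1 * w1 \<and> b p = u2 * w2 \<and> c p = u1 * w2 \<and> d p = u2 * w1"
    by (intro allI rank_one_factorization assms)
  then obtain u1 u2 w1 w2 where *: "\<forall>p. 0 \<le> u1 p \<and> 0 \<le> u2 p \<and> 0 \<le> w1 p \<and> 0 \<le> w2 p \<and>
    a p = u1 p * w1 p \<and> b p = u2 p * w2 p \<and> c p = u1 p * w2 p \<and> d p = u2 p * w1 p"
    by metis
  then have "a p * b q + a q * b p = c p * d q + c q * d p \<longleftrightarrow>
       u1 p * u2 q = u1 q * u2 p \<or> w1 p * w2 q = w1 q * w2 p" for p q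
    using polarized_determinant[of "u1 p" "w1 p" "u2 q" "w2 q" "u1 q" "w1 q" "u2 p" "w2 p"] by simp
  with * show ?thesis by (intro exI[of _ u1] exI[of _ u2] exI[of _ w1] exI[of _ w2]) auto
qed

lemma pos_factors: "0 < x * y \<Longrightarrow> 0 \<le> x \<Longrightarrow> 0 \<le> y \<Longrightarrow> 0 < x \<and> 0 < y" for x y :: real
  by (auto simp: zero_less_mult_iff)

text \<open>
  Suppose that for \<open>p\<close> and \<open>q\<close> neither the columns nor the rows are parallel. Then
  \<open>c (sup p q) * d (inf p q)\<close> is nonzero, so the vectors at the join and the meet are nonzero.
  Comparability forces both of them to share their column with one of \<open>p\<close>, \<open>q\<close> and
  their row with the other, say the column with \<open>p\<close> and the row with \<open>q\<close>. The inequality for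
  \<open>p\<close> and the meet compares the slopes of the rows of \<open>p\<close> and \<open>q\<close> in one direction, the
  inequality for \<open>p\<close> and the join compares them in the other; so these rows are parallel after all.
\<close>

lemma polarized_identity_from_comparable:
  fixes a b c d :: "'p::lattice \<Rightarrow> real"
  assumes nonneg: "\<And>p. 0 \<le> a p" "\<And>p. 0 \<le> b p" "\<And>p. 0 \<le> c p" "\<And>p. 0 \<le> d p"
    and le: "\<And>p q. a p * b q \<le> c (sup p q) * d (inf p q)"
    and comparable: "\<And>p q. p \<le> q \<Longrightarrow> a p * b q + a q * b p = c p * d q + c q * d p"
    and zero: "\<And>p q. c (sup p q) * d (inf p q) = 0 \<Longrightarrow> c p * d q = 0"
  shows "a p * b q + a q * b p = c p * d q + c q * d p"
proof (rule ccontr)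
  assume neq: "\<not> ?thesis"
  have diag: "a p * b p = c p * d p" for p
    using comparable[of p p] by simp
  obtain u1 u2 w1 w2 where
    uw: "\<forall>p. 0 \<le> u1 p \<and> 0 \<le> u2 p \<and> 0 \<le> w1 p \<and> 0 \<le> w2 p"
    and abcd': "\<forall>p. a p = u1 p * w1 p \<and> b p = u2 p * w2 p \<and> c p = u1 p * w2 p \<and> d p = u2 p * w1 p"
    and polar: "\<forall>p q. a p * b q + a q * b p = c p * d q + c q * d p \<longleftrightarrow>
      u1 p * u2 q = u1 q * u2 p \<or> w1 p * w2 q = w1 q * w2 p"
    using rank_one_functions[of a b c d, OF nonneg diag] by blast
  have uw0: "\<And>p. 0 \<le> u1 p" "\<And>p. 0 \<le> u2 p" "\<And>p. 0 \<le> w1 p" "\<And>p. 0 \<le> w2 p"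
    using uw by blast+
  have abcd: "\<And>p. a p = u1 p * w1 p" "\<And>p. b p = u2 p * w2 p"
      "\<And>p. c p = u1 p * w2 p" "\<And>p. d p = u2 p * w1 p"
    using abcd' by blast+
  \<comment> \<open>\<open>U\<close> and \<open>W\<close> are the relations of having parallel columns and parallel rows.\<close>
  define U where "U p q \<longleftrightarrow> u1 p * u2 q = u1 q * u2 p" for p q
  define W where "W p q \<longleftrightarrow> w1 p * w2 q = w1 q * w2 p" for p q
  have U_trans: "U x z" if "u1 y \<noteq> 0 \<or> u2 y \<noteq> 0" "U x y" "U z y" for x y z
    using parallel_trans[of "u1 y" "u2 y" "u1 x" "u2 x" "u1 z" "u2 z"] that by (simp add: U_def)
  have W_trans: "W x z" if "w1 y \<noteq> 0 \<or> w2 y \<noteq> 0" "W x y" "W z y" for x y z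
    using parallel_trans[of "w1 y" "w2 y" "w1 x" "w2 x" "w1 z" "w2 z"] that by (simp add: W_def)
  have sym: "U x y \<longleftrightarrow> U y x" "W x y \<longleftrightarrow> W y x" for x y
    by (auto simp: U_def W_def)
  have UW: "U x y \<or> W x y" if "x \<le> y \<or> y \<le> x" for x y
    using that comparable[of x y] comparable[of y x] polar
    by (auto simp: U_def W_def)
  \<comment> \<open>The join \<open>s\<close> has the column of \<open>p\<close> and the row of \<open>q\<close>; up to exchanging \<open>p\<close> and \<open>q\<close> this is the
    only possibility.\<close>
  have no_mixed: False
    if Ups: "U p s" and Wqs: "W q s" and nU: "\<not> U p q" and nW: "\<not> W p q"
      and s: "s = sup p q" and i: "i = inf p q" and pos: "0 < c s" "0 < d i" for p q s i
  proof -
    have s0: "0 < u1 s" "0 < w2 s" and i0: "0 < u2 i" "0 < w1 i"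
      using pos uw0 pos_factors by (metis abcd(3,4))+
    have p0: "u1 p \<noteq> 0 \<or> u2 p \<noteq> 0" and q0: "w1 q \<noteq> 0 \<or> w2 q \<noteq> 0"
      using nU nW by (auto simp: U_def W_def)
    have "U p i \<and> W q i"
    proof -
      have "i \<le> p" "i \<le> q" "p \<le> s"
        by (simp_all add: s i)
      then have "U i s \<or> W i s" "U p i \<or> W p i" "U q i \<or> W q i"
        using UW[of i s] UW[of p i] UW[of q i] order_trans[of i p s] by blast+
      moreover have "\<not> (U p i \<and> U q i)" "\<not> (W p i \<and> W q i)"
        using U_trans[of i p q] W_trans[of i p q] i0 nU nW by (metis less_irrefl)+
      moreover have "\<not> (U i s \<and> U q i)"
        using U_trans[of s p i] U_trans[of i p q] s0 i0 Ups nU by auto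
      moreover have "\<not> (W i s \<and> W p i)"
        using W_trans[of s q i] W_trans[of i p q] s0 i0 Wqs nW by auto
      ultimately show ?thesis by blast
    qed
    then have "U i s" "W i s"
      using U_trans[OF p0, of i s] W_trans[OF q0, of i s] Ups Wqs
        sym(1)[of i p] sym(1)[of s p] sym(2)[of i q] sym(2)[of s q] by simp_all
    \<comment> \<open>Cancelling in the two inequalities below needs strictly positive entries. Those of \<open>s\<close> and \<open>i\<close>
      come from \<open>pos\<close>, since nonzero entries of parallel vectors transfer.\<close>
    have u_pos: "0 < u2 s" "0 < u1 i" "0 < u1 p" "0 < u2 p"
      and w_pos: "0 < w1 s" "0 < w2 i"
    proof -
      have "u1 i * u2 s \<noteq> 0" "w1 s * w2 i \<noteq> 0"
        using \<open>U i s\<close> \<open>W i s\<close> s0 i0 by (auto simp: U_def W_def)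
      then show u: "0 < u2 s" "0 < u1 i" "0 < w1 s" "0 < w2 i"
        using uw0 by (auto simp: less_le)
      have "u1 p * u2 s = u1 s * u2 p" using Ups by (simp add: U_def)
      then show "0 < u1 p" "0 < u2 p"
        using p0 s0 u uw0 by (auto simp: less_le)
    qed
    have "a p * b i \<le> c p * d i" "a s * b p \<le> c s * d p"
      using le[of p i] le[of s p] by (simp_all add: s i sup_absorb1 inf_absorb2)
    then have "(u1 p * u2 i) * (w1 p * w2 i) \<le> (u1 p * u2 i) * (w2 p * w1 i)"
      "(u1 s * u2 p) * (w1 s * w2 p) \<le> (u1 s * u2 p) * (w2 s * w1 p)"
      by (simp_all add: abcd mult_ac)
    then have pi: "w1 p * w2 i \<le> w2 p * w1 i" and sp: "w1 s * w2 p \<le> w2 s * w1 p"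
      using u_pos s0 i0 by (simp_all add: mult_le_cancel_left_pos)
    have "w2 i * (w1 p * w2 s) \<le> w2 s * (w2 p * w1 i)"
      using mult_left_mono[OF pi, of "w2 s"] s0 by (simp add: mult_ac)
    also have "\<dots> = w2 i * (w1 s * w2 p)"
      using \<open>W i s\<close> by (simp add: W_def algebra_simps)
    finally have "w1 p * w2 s \<le> w1 s * w2 p"
      using w_pos by (simp add: mult_le_cancel_left_pos)
    with sp have "W p s"
      by (simp add: W_def mult.commute)
    then show False
      using W_trans[of s p q] Wqs nW s0 by auto
  qed
  show False
  proof (cases "c (sup p q) * d (inf p q) = 0")
    case True
    then have "c (sup q p) * d (inf q p) = 0"
      by (simp only: sup.commute inf.commute)
    with True have "a p * b q \<le> 0" "a q * b p \<le> 0" "c p * d q = 0" "c q * d p = 0"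
      using le[of p q] le[of q p] zero[of p q] zero[of q p] by presburger+
    moreover have "0 \<le> a p * b q" "0 \<le> a q * b p"
      using nonneg by simp_all
    ultimately have "a p * b q = 0" "a q * b p = 0" "c p * d q = 0" "c q * d p = 0"
      by simp_all
    then show False using neq by (simp only:)
  next
    case False
    then have pos: "0 < c (sup p q)" "0 < d (inf p q)"
      using nonneg by (auto simp: less_le)
    have n: "\<not> U p q" "\<not> W p q" "\<not> U q p" "\<not> W q p"
      using neq polar by (auto simp: U_def W_def)
    have s0: "0 < u1 (sup p q)" "0 < w2 (sup p q)"
      using pos uw0 pos_factors by (metis abcd(3,4))+
    have "U p (sup p q) \<or> W p (sup p q)" "U q (sup p q) \<or> W q (sup p q)"
      by (rule UW, simp)+
    moreover have "\<not> (U p (sup p q) \<and> U q (sup p q))" "\<not> (W p (sup p q) \<and> W q (sup p q))"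
      using U_trans[of "sup p q" p q] W_trans[of "sup p q" p q] s0 n by auto
    ultimately consider "U p (sup p q)" "W q (sup p q)" | "U q (sup p q)" "W p (sup p q)"
      by blast
    then show False
    proof cases
      case 1
      show False by (rule no_mixed[OF 1 n(1,2) refl refl pos])
    next
      case 2
      show False by (rule no_mixed[OF 2 n(3,4) sup.commute inf.commute pos])
    qed
  qed
qed

text \<open>
  The constant is the slope of the common row; it is finite and nonzero because neither \<open>a\<close>
  nor \<open>c\<close> vanishes identically.
\<close>

lemma proportional_if_parallel:
  fixes a b c d :: "'p \<Rightarrow> real"
  assumes abcd: "\<And>p. a p = u1 p * w1 p" "\<And>p. b p = u2 p * w2 p"
      "\<And>p. c p = u1 p * w2 p" "\<And>p. d p = u2 p * w1 p"
    and par: "\<And>p q. (u1 p \<noteq> 0 \<or> u2 p \<noteq> 0) \<Longrightarrow> (u1 q \<noteq> 0 \<or> u2 q \<noteq> 0) \<Longrightarrow> w1 p * w2 q = w1 q * w2 p"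
    and "a p0 \<noteq> 0" "c p1 \<noteq> 0"
  shows "\<exists>\<theta>. \<theta> \<noteq> 0 \<and> (\<forall>p. a p = \<theta> * c p) \<and> (\<forall>p. b p = inverse \<theta> * d p)"
proof (intro exI conjI allI)
  let ?\<theta> = "w1 p0 / w2 p0"
  have "w1 p0 \<noteq> 0" "u1 p0 \<noteq> 0" "w2 p1 \<noteq> 0" "u1 p1 \<noteq> 0"
    using \<open>a p0 \<noteq> 0\<close> \<open>c p1 \<noteq> 0\<close> by (auto simp: abcd)
  then have "w2 p0 \<noteq> 0"
    using par[of p0 p1] by auto
  then show "?\<theta> \<noteq> 0" using \<open>w1 p0 \<noteq> 0\<close> by simp
  have "w1 p * w2 p0 = w1 p0 * w2 p" if "u1 p \<noteq> 0 \<or> u2 p \<noteq> 0" for p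
    using par[OF that, of p0] \<open>u1 p0 \<noteq> 0\<close> by simp
  then show "a p = ?\<theta> * c p" "b p = inverse ?\<theta> * d p" for p
    using \<open>w1 p0 \<noteq> 0\<close> \<open>w2 p0 \<noteq> 0\<close>
    by (cases "u1 p \<noteq> 0 \<or> u2 p \<noteq> 0"; simp add: abcd field_simps)+
qed

text \<open>
  Unless one of the four functions vanishes identically, the factorization into columns and rows
  reduces the claim to the case of parallel rows, or to its mirror image with the columns.
  Restricting to nonzero vectors is what makes parallelism transitive.
\<close>

lemma proportional_if_polarized_identity:
  fixes a b c d :: "'p \<Rightarrow> real"
  assumes nonneg: "\<And>p. 0 \<le> a p" "\<And>p. 0 \<le> b p" "\<And>p. 0 \<le> c p" "\<And>p. 0 \<le> d p"
    and polarized: "\<And>p q. a p * b q + a q * b p = c p * d q + c q * d p"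
  shows "(((\<forall>p. a p = 0) \<or> (\<forall>p. b p = 0)) \<and> ((\<forall>p. c p = 0) \<or> (\<forall>p. d p = 0))) \<or>
    (\<exists>\<theta>. \<theta> \<noteq> 0 \<and>
      (((\<forall>p. a p = \<theta> * c p) \<and> (\<forall>p. b p = inverse \<theta> * d p)) \<or>
       ((\<forall>p. a p = \<theta> * d p) \<and> (\<forall>p. b p = inverse \<theta> * c p))))"
proof -
  have sum0: "x * y = 0" if "x * y + x' * y' = 0" "0 \<le> x" "0 \<le> y" "0 \<le> x'" "0 \<le> y'" for x y x' y' :: real
    using that by (metis add_nonneg_eq_0_iff mult_nonneg_nonneg)
  consider (ab) "(\<forall>p. a p = 0) \<or> (\<forall>p. b p = 0)" | (cd) "(\<forall>p. c p = 0) \<or> (\<forall>p. d p = 0)"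
    | (nonzero) pa pb pc pd where "a pa \<noteq> 0" "b pb \<noteq> 0" "c pc \<noteq> 0" "d pd \<noteq> 0"
    by blast
  then show ?thesis
  proof cases
    case ab
    then have "c p * d q = 0" for p q
      using polarized[of p q] nonneg by (intro sum0[of _ _ "c q" "d p"]) auto
    then show ?thesis using ab by auto
  next
    case cd
    then have "a p * b q = 0" for p q
      using polarized[of p q] nonneg by (intro sum0[of _ _ "a q" "b p"]) auto
    then show ?thesis using cd by auto
  next
    case nonzero
    have diag: "a p * b p = c p * d p" for p
      using polarized[of p p] by simp
    obtain u1 u2 w1 w2 where
      uw: "\<forall>p. 0 \<le> u1 p \<and> 0 \<le> u2 p \<and> 0 \<le> w1 p \<and> 0 \<le> w2 p"
      and abcd': "\<forall>p. a p = u1 p * w1 p \<and> b p = u2 p * w2 p \<and> c p = u1 p * w2 p \<and> d p = u2 p * w1 p"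
      and polar: "\<forall>p q. a p * b q + a q * b p = c p * d q + c q * d p \<longleftrightarrow>
        u1 p * u2 q = u1 q * u2 p \<or> w1 p * w2 q = w1 q * w2 p"
      using rank_one_functions[of a b c d, OF nonneg diag] by blast
    have uw0: "\<And>p. 0 \<le> u1 p" "\<And>p. 0 \<le> u2 p" "\<And>p. 0 \<le> w1 p" "\<And>p. 0 \<le> w2 p"
      using uw by blast+
    have abcd: "\<And>p. a p = u1 p * w1 p" "\<And>p. b p = u2 p * w2 p"
        "\<And>p. c p = u1 p * w2 p" "\<And>p. d p = u2 p * w1 p"
      using abcd' by blast+
    have UW: "u1 p * u2 q = u1 q * u2 p \<or> w1 p * w2 q = w1 q * w2 p" for p q
      using polar polarized by blast
    define Nu where "Nu p \<longleftrightarrow> u1 p \<noteq> 0 \<or> u2 p \<noteq> 0" for p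
    define Nw where "Nw p \<longleftrightarrow> w1 p \<noteq> 0 \<or> w2 p \<noteq> 0" for p
    have U_trans: "u1 x * u2 z = u1 z * u2 x"
      if "Nu y" "u1 x * u2 y = u1 y * u2 x" "u1 z * u2 y = u1 y * u2 z" for x y z
      using parallel_trans[of "u1 y" "u2 y" "u1 x" "u2 x" "u1 z" "u2 z"] that by (simp add: Nu_def)
    have W_trans: "w1 x * w2 z = w1 z * w2 x"
      if "Nw y" "w1 x * w2 y = w1 y * w2 x" "w1 z * w2 y = w1 y * w2 z" for x y z
      using parallel_trans[of "w1 y" "w2 y" "w1 x" "w2 x" "w1 z" "w2 z"] that by (simp add: Nw_def)
    \<comment> \<open>If two rows with nonzero columns are not parallel, the two columns are. No nonzero row is
      parallel to both of these rows, so its column is parallel to one, hence to both, of the two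
      columns.\<close>
    consider (W) "\<And>p q. Nu p \<Longrightarrow> Nu q \<Longrightarrow> w1 p * w2 q = w1 q * w2 p"
      | (U) "\<And>p q. Nw p \<Longrightarrow> Nw q \<Longrightarrow> u1 p * u2 q = u1 q * u2 p"
    proof (cases "\<forall>p q. Nu p \<longrightarrow> Nu q \<longrightarrow> w1 p * w2 q = w1 q * w2 p")
      case False
      then obtain p q where pq: "Nu p" "Nu q" "w1 p * w2 q \<noteq> w1 q * w2 p"
        by blast
      have *: "u1 x * u2 p = u1 p * u2 x" if "Nw x" for x
      proof (rule ccontr)
        assume no: "u1 x * u2 p \<noteq> u1 p * u2 x"
        have "u1 p * u2 q = u1 q * u2 p" using UW pq(3) by blast
        then have "u1 x * u2 q \<noteq> u1 q * u2 x"
          using U_trans[OF pq(2)] no by blast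
        then have "w1 p * w2 x = w1 x * w2 p" "w1 q * w2 x = w1 x * w2 q"
          using UW[of x p] UW[of x q] no by simp_all
        then show False using W_trans[OF that] pq(3) by blast
      qed
      have "u1 x * u2 y = u1 y * u2 x" if "Nw x" "Nw y" for x y
        using U_trans[OF pq(1)] * that by blast
      then show ?thesis using that by blast
    qed (use that in blast)
    then show ?thesis
    proof cases
      case W
      then have "\<exists>\<theta>. \<theta> \<noteq> 0 \<and> (\<forall>p. a p = \<theta> * c p) \<and> (\<forall>p. b p = inverse \<theta> * d p)"
        using nonzero by (intro proportional_if_parallel[OF abcd, where ?p0.0 = pa and ?p1.0 = pc]) (auto simp: Nu_def)
      then show ?thesis by blast
    next
      case U
      then have "\<exists>\<theta>. \<theta> \<noteq> 0 \<and> (\<forall>p. a p = \<theta> * d p) \<and> (\<forall>p. b p = inverse \<theta> * c p)"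
        using nonzero
        by (intro proportional_if_parallel[where ?u1.0 = w1 and ?w1.0 = u1 and ?u2.0 = w2 and ?w2.0 = u2 and ?p0.0 = pa and ?p1.0 = pd])
          (auto simp: Nw_def abcd mult.commute)
      then show ?thesis by blast
    qed
  qed
qed


section \<open>Equality of products of Schur series\<close>

lemma ps_mult_schur_series_commute:
  "schur_series a \<odot> schur_series b = schur_series b \<odot> schur_series a"
proof
  fix m
  show "(schur_series a \<odot> schur_series b) m = (schur_series b \<odot> schur_series a) m"
    unfolding ps_mult_schur_series
    by (rule sum.reindex_bij_witness[of _ prod.swap prod.swap])
      (auto simp: ssyt_pairs_def add.commute mult.commute)
qed

lemma ps_mult_schur_series_cong:
  assumes "\<And>p q. a p * b q = c p * d q"
  shows "schur_series a \<odot> schur_series b = schur_series c \<odot> schur_series d"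
  by (simp add: fun_eq_iff ps_mult_schur_series assms)

theorem theorem3p8:
  fixes a b c d :: "partition \<Rightarrow> real"
  assumes "\<And>p. a p \<ge> 0" and "\<And>p. b p \<ge> 0" and "\<And>p. c p \<ge> 0" and "\<And>p. d p \<ge> 0"
    and "\<And>p q. a p * b q \<le> c (sup p q) * d (inf p q)"
  shows "schur_series a \<odot> schur_series b = schur_series c \<odot> schur_series d \<longleftrightarrow>
    (((\<forall>p. a p = 0) \<or> (\<forall>p. b p = 0)) \<and> ((\<forall>p. c p = 0) \<or> (\<forall>p. d p = 0))) \<or>
    (\<exists>\<theta>. \<theta> \<noteq> 0 \<and>
      (((\<forall>p. a p = \<theta> * c p) \<and> (\<forall>p. b p = inverse \<theta> * d p)) \<or>
       ((\<forall>p. a p = \<theta> * d p) \<and> (\<forall>p. b p = inverse \<theta> * c p))))"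
  (is "?eq \<longleftrightarrow> ?trivial \<or> ?proportional")
proof
  assume ?eq
  note fibre = exchange_equality[of a b c d, OF assms \<open>?eq\<close>]
  have "a p * b q + a q * b p = c p * d q + c q * d p" for p q
  proof (rule polarized_identity_from_comparable[of a b c d, OF assms])
    show "a p * b q + a q * b p = c p * d q + c q * d p" if "p \<le> q" for p q
      using fibre that by (rule comparable_identity)
    show "c p * d q = 0" if "c (sup p q) * d (inf p q) = 0" for p q
      using assms(3,4,5) fibre that by (rule vanishing_product)
  qed
  then show "?trivial \<or> ?proportional"
    by (rule proportional_if_polarized_identity[of a b c d, OF assms(1-4)])
next
  assume "?trivial \<or> ?proportional"
  then show ?eq
  proof
    assume ?trivial
    then have "a p * b q = c p * d q" for p q
      by auto
    then show ?eq
      by (rule ps_mult_schur_series_cong)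
  next
    assume ?proportional
    then obtain \<theta> where \<theta>: "\<theta> \<noteq> 0"
      and "(\<forall>p. a p = \<theta> * c p) \<and> (\<forall>p. b p = inverse \<theta> * d p) \<or>
        (\<forall>p. a p = \<theta> * d p) \<and> (\<forall>p. b p = inverse \<theta> * c p)"
      by blast
    then show ?eq
    proof (elim disjE conjE)
      assume "\<forall>p. a p = \<theta> * c p" "\<forall>p. b p = inverse \<theta> * d p"
      then show ?eq
        using \<theta> by (intro ps_mult_schur_series_cong) simp
    next
      assume "\<forall>p. a p = \<theta> * d p" "\<forall>p. b p = inverse \<theta> * c p"
      then have "schur_series a \<odot> schur_series b = schur_series d \<odot> schur_series c"
        using \<theta> by (intro ps_mult_schur_series_cong) simp
      then show ?eq
        using ps_mult_schur_series_commute by simp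
    qed
  qed
qed

end
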